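(* Let $\Phi_{a}=(\Delta_{a},\Gamma_{a})$ and $\Phi_{b}=(\Delta_{b},\Gamma_{b})$ be partitionable relative simplicial complexes such that no facet of one is properly contained in a facet of the other, and let $$\Sigma := (\Gamma_{a}\setminus\Delta_{b})\,\cup\,(\Gamma_{b}\setminus\Delta_{a})\,\cup\,(\Gamma_{a}\cap\Gamma_{b}).$$ The complex $\Phi=(\Delta_{a}\cup\Delta_{b},\Sigma)$ is partitionable if the following conditions are met: (G1) $\Gamma_{a}\cup\Gamma_{b}\supseteq\Delta_{a}\cap\Delta_{b}$; (G2) $\Sigma$ is a subcomplex of $\Delta_{a}\cup\Delta_{b}$ (in particular, the set system $\Sigma$ is a simplicial complex).
   Context: A simplicial complex is a collection of subsets of a finite ground set closed under inclusion; the empty collection $\varnothing$ and the complex $\{\varnothing\}$ are distinct, and the empty set is a face of every nonempty complex. A relative simplicial complex $(\Delta,\Gamma)$ is a pair of simplicial complexes with $\Gamma$ a subcomplex of $\Delta$ ($\Gamma=\varnothing$ allowed). Its faces are the faces of $\Delta$ not in $\Gamma$, i.e. the elements of the set difference $\Delta\setminus\Gamma$ of set systems, and its facets are the inclusion-maximal such faces. Unions, intersections and differences of complexes are taken as set systems. A relative complex $(\Delta,\Gamma)$ is partitionable if $\Delta\setminus\Gamma$ is the disjoint union of intervals $[R(\sigma),\sigma]=\{\rho : R(\sigma)\subseteq\rho\subseteq\sigma\}$, one for each facet $\sigma$ of $(\Delta,\Gamma)$, where $R(\sigma)\subseteq\sigma$ is a face of $(\Delta,\Gamma)$. *)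

theory Defs
  imports Main "HOL-Library.Disjoint_Sets"
begin

definition simplicial_complex :: "'a set set \<Rightarrow> bool" where
  "simplicial_complex \<Delta> \<longleftrightarrow>
     (\<exists>V. finite V \<and> \<Delta> \<subseteq> Pow V) \<and> (\<forall>\<sigma>\<in>\<Delta>. \<forall>\<tau>. \<tau> \<subseteq> \<sigma> \<longrightarrow> \<tau> \<in> \<Delta>)"

definition subcomplex :: "'a set set \<Rightarrow> 'a set set \<Rightarrow> bool" where
  "subcomplex \<Gamma> \<Delta> \<longleftrightarrow> simplicial_complex \<Gamma> \<and> \<Gamma> \<subseteq> \<Delta>"

text \<open>A relative complex is a pair; its second component is the subcomplex that is removed.\<close>

definition relative_complex :: "'a set set \<times> 'a set set \<Rightarrow> bool" where
  "relative_complex \<Phi> \<longleftrightarrow> simplicial_complex (fst \<Phi>) \<and> subcomplex (snd \<Phi>) (fst \<Phi>)"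

definition faces :: "'a set set \<times> 'a set set \<Rightarrow> 'a set set" where
  "faces \<Phi> = fst \<Phi> - snd \<Phi>"

definition facets :: "'a set set \<times> 'a set set \<Rightarrow> 'a set set" where
  "facets \<Phi> = {\<sigma> \<in> faces \<Phi>. \<forall>\<tau>\<in>faces \<Phi>. \<sigma> \<subseteq> \<tau> \<longrightarrow> \<tau> = \<sigma>}"

text \<open>
  Sets are ordered by inclusion, so the order interval \<open>{R \<sigma>..\<sigma>}\<close> is the interval
  \<open>[R(\<sigma>), \<sigma>]\<close> of all sets between \<open>R \<sigma>\<close> and \<open>\<sigma>\<close>.
  Only a genuine relative complex is called partitionable.
\<close>

definition partitionable :: "'a set set \<times> 'a set set \<Rightarrow> bool" where
  "partitionable \<Phi> \<longleftrightarrow> relative_complex \<Phi> \<and>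
     (\<exists>R. (\<forall>\<sigma>\<in>facets \<Phi>. R \<sigma> \<in> faces \<Phi> \<and> R \<sigma> \<subseteq> \<sigma>) \<and>
          disjoint_family_on (\<lambda>\<sigma>. {R \<sigma>..\<sigma>}) (facets \<Phi>) \<and>
          faces \<Phi> = (\<Union>\<sigma>\<in>facets \<Phi>. {R \<sigma>..\<sigma>}))"

end

theory Submission
  imports Defs
begin

text \<open>
  Condition (G1) says that a common member of \<open>\<Delta>\<^sub>a\<close> and \<open>\<Delta>\<^sub>b\<close> is removed from at least one of the
  two complexes, and \<open>\<Sigma>\<close> is chosen so that it is removed from the union exactly when it is removed
  from both. Hence the faces of the glued complex are the disjoint union of the faces of the pieces
  (\<open>faces_glued\<close>, \<open>faces_disjoint\<close>). Condition (G2) makes the glued pair a relative complex.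

  What remains concerns only the systems of faces. Since the pieces are disjoint and no facet of one
  is properly contained in a facet of the other, the facets of the union are the facets of the pieces
  (\<open>facets_disjoint_union\<close>). The two partitions into intervals can therefore simply be put side by
  side: intervals from different pieces cannot meet because these have no common face
  (\<open>partitionable_disjoint_union\<close>).
\<close>

lemma partitionable_imp_relative_complex:
  "partitionable \<Phi> \<Longrightarrow> relative_complex \<Phi>"
  by (simp add: partitionable_def)

lemma facets_subset_faces: "facets \<Phi> \<subseteq> faces \<Phi>"
  by (auto simp: facets_def)

text \<open>
  The interval of the partition that contains \<open>\<rho>\<close> ends in a facet above \<open>\<rho>\<close>.
\<close>

lemma partitionable_face_below_facet:
  assumes "partitionable \<Phi>" and "\<rho> \<in> faces \<Phi>"
  obtains \<sigma> where "\<sigma> \<in> facets \<Phi>" and "\<rho> \<subseteq> \<sigma>"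
proof -
  obtain R where "faces \<Phi> = (\<Union>\<sigma>\<in>facets \<Phi>. {R \<sigma>..\<sigma>})"
    using assms(1) unfolding partitionable_def by blast
  with assms(2) obtain \<sigma> where "\<sigma> \<in> facets \<Phi>" and "\<rho> \<in> {R \<sigma>..\<sigma>}"
    by blast
  then show thesis
    by (simp add: that)
qed

text \<open>
  A facet \<open>\<sigma>\<close> of one piece stays maximal among the faces of the other piece: a face of the other
  piece above \<open>\<sigma>\<close> lies below a facet there, which would have to equal \<open>\<sigma>\<close> by the hypothesis on
  facets, and then \<open>\<sigma>\<close> would be a face of both pieces.
\<close>

lemma facet_not_below_face_of_other:
  assumes "partitionable \<Phi>\<^sub>b"
    and "faces \<Phi>\<^sub>a \<inter> faces \<Phi>\<^sub>b = {}"
    and "\<And>\<tau>. \<tau> \<in> facets \<Phi>\<^sub>b \<Longrightarrow> \<not> \<sigma> \<subset> \<tau>"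
    and "\<sigma> \<in> facets \<Phi>\<^sub>a" and "\<rho> \<in> faces \<Phi>\<^sub>b"
  shows "\<not> \<sigma> \<subseteq> \<rho>"
proof
  assume "\<sigma> \<subseteq> \<rho>"
  obtain \<tau> where "\<tau> \<in> facets \<Phi>\<^sub>b" and "\<rho> \<subseteq> \<tau>"
    using assms(1,5) by (rule partitionable_face_below_facet)
  with \<open>\<sigma> \<subseteq> \<rho>\<close> assms(3) have "\<sigma> = \<tau>"
    by blast
  with \<open>\<tau> \<in> facets \<Phi>\<^sub>b\<close> assms(2,4) show False
    using facets_subset_faces by blast
qed

lemma facets_disjoint_union:
  assumes part_a: "partitionable \<Phi>\<^sub>a" and part_b: "partitionable \<Phi>\<^sub>b"
    and not_nested: "\<forall>\<sigma>\<in>facets \<Phi>\<^sub>a. \<forall>\<tau>\<in>facets \<Phi>\<^sub>b. \<not> \<sigma> \<subset> \<tau> \<and> \<not> \<tau> \<subset> \<sigma>"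
    and faces_eq: "faces \<Phi> = faces \<Phi>\<^sub>a \<union> faces \<Phi>\<^sub>b"
    and disj: "faces \<Phi>\<^sub>a \<inter> faces \<Phi>\<^sub>b = {}"
  shows "facets \<Phi> = facets \<Phi>\<^sub>a \<union> facets \<Phi>\<^sub>b"
proof
  show "facets \<Phi> \<subseteq> facets \<Phi>\<^sub>a \<union> facets \<Phi>\<^sub>b"
    unfolding facets_def faces_eq by blast
next
  have a_not_below_b: "\<not> \<sigma> \<subseteq> \<rho>" if "\<sigma> \<in> facets \<Phi>\<^sub>a" "\<rho> \<in> faces \<Phi>\<^sub>b" for \<sigma> \<rho>
    by (rule facet_not_below_face_of_other[OF part_b disj _ that]) (use not_nested that(1) in blast)
  have b_not_below_a: "\<not> \<sigma> \<subseteq> \<rho>" if "\<sigma> \<in> facets \<Phi>\<^sub>b" "\<rho> \<in> faces \<Phi>\<^sub>a" for \<sigma> \<rho>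
  proof (rule facet_not_below_face_of_other[OF part_a _ _ that])
    show "faces \<Phi>\<^sub>b \<inter> faces \<Phi>\<^sub>a = {}"
      using disj by blast
  qed (use not_nested that(1) in blast)
  show "facets \<Phi>\<^sub>a \<union> facets \<Phi>\<^sub>b \<subseteq> facets \<Phi>"
  proof
    fix \<sigma>
    assume \<sigma>: "\<sigma> \<in> facets \<Phi>\<^sub>a \<union> facets \<Phi>\<^sub>b"
    then have "\<sigma> \<in> faces \<Phi>"
      using faces_eq facets_subset_faces by blast
    moreover have "\<tau> = \<sigma>" if "\<tau> \<in> faces \<Phi>" "\<sigma> \<subseteq> \<tau>" for \<tau>
      using \<sigma>
    proof
      assume "\<sigma> \<in> facets \<Phi>\<^sub>a"
      with that show ?thesis
        using a_not_below_b unfolding facets_def faces_eq by blast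
    next
      assume "\<sigma> \<in> facets \<Phi>\<^sub>b"
      with that show ?thesis
        using b_not_below_a unfolding facets_def faces_eq by blast
    qed
    ultimately show "\<sigma> \<in> facets \<Phi>"
      unfolding facets_def by blast
  qed
qed

lemma partitionable_disjoint_union:
  assumes part_a: "partitionable \<Phi>\<^sub>a" and part_b: "partitionable \<Phi>\<^sub>b"
    and not_nested: "\<forall>\<sigma>\<in>facets \<Phi>\<^sub>a. \<forall>\<tau>\<in>facets \<Phi>\<^sub>b. \<not> \<sigma> \<subset> \<tau> \<and> \<not> \<tau> \<subset> \<sigma>"
    and rel: "relative_complex \<Phi>"
    and faces_eq: "faces \<Phi> = faces \<Phi>\<^sub>a \<union> faces \<Phi>\<^sub>b"
    and disj: "faces \<Phi>\<^sub>a \<inter> faces \<Phi>\<^sub>b = {}"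
  shows "partitionable \<Phi>"
proof -
  have facets_eq: "facets \<Phi> = facets \<Phi>\<^sub>a \<union> facets \<Phi>\<^sub>b"
    using part_a part_b not_nested faces_eq disj by (rule facets_disjoint_union)
  obtain R\<^sub>a where
    R\<^sub>a: "\<forall>\<sigma>\<in>facets \<Phi>\<^sub>a. R\<^sub>a \<sigma> \<in> faces \<Phi>\<^sub>a \<and> R\<^sub>a \<sigma> \<subseteq> \<sigma>"
      "disjoint_family_on (\<lambda>\<sigma>. {R\<^sub>a \<sigma>..\<sigma>}) (facets \<Phi>\<^sub>a)"
      "faces \<Phi>\<^sub>a = (\<Union>\<sigma>\<in>facets \<Phi>\<^sub>a. {R\<^sub>a \<sigma>..\<sigma>})"
    using part_a unfolding partitionable_def by blast
  obtain R\<^sub>b where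
    R\<^sub>b: "\<forall>\<sigma>\<in>facets \<Phi>\<^sub>b. R\<^sub>b \<sigma> \<in> faces \<Phi>\<^sub>b \<and> R\<^sub>b \<sigma> \<subseteq> \<sigma>"
      "disjoint_family_on (\<lambda>\<sigma>. {R\<^sub>b \<sigma>..\<sigma>}) (facets \<Phi>\<^sub>b)"
      "faces \<Phi>\<^sub>b = (\<Union>\<sigma>\<in>facets \<Phi>\<^sub>b. {R\<^sub>b \<sigma>..\<sigma>})"
    using part_b unfolding partitionable_def by blast
  define R where "R \<sigma> = (if \<sigma> \<in> facets \<Phi>\<^sub>a then R\<^sub>a \<sigma> else R\<^sub>b \<sigma>)" for \<sigma>
  have R_a: "R \<sigma> = R\<^sub>a \<sigma>" if "\<sigma> \<in> facets \<Phi>\<^sub>a" for \<sigma>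
    using that by (simp add: R_def)
  have R_b: "R \<sigma> = R\<^sub>b \<sigma>" if "\<sigma> \<in> facets \<Phi>\<^sub>b" for \<sigma>
    using that disj facets_subset_faces[of \<Phi>\<^sub>a] facets_subset_faces[of \<Phi>\<^sub>b] by (auto simp: R_def)
  have faces_a: "faces \<Phi>\<^sub>a = (\<Union>\<sigma>\<in>facets \<Phi>\<^sub>a. {R \<sigma>..\<sigma>})"
    using R\<^sub>a(3) by (simp add: R_a)
  have faces_b: "faces \<Phi>\<^sub>b = (\<Union>\<sigma>\<in>facets \<Phi>\<^sub>b. {R \<sigma>..\<sigma>})"
    using R\<^sub>b(3) by (simp add: R_b)
  have "R \<sigma> \<in> faces \<Phi> \<and> R \<sigma> \<subseteq> \<sigma>" if "\<sigma> \<in> facets \<Phi>" for \<sigma>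
    using that unfolding facets_eq faces_eq
  proof
    assume "\<sigma> \<in> facets \<Phi>\<^sub>a"
    then show "R \<sigma> \<in> faces \<Phi>\<^sub>a \<union> faces \<Phi>\<^sub>b \<and> R \<sigma> \<subseteq> \<sigma>"
      using R\<^sub>a(1) by (simp add: R_a)
  next
    assume "\<sigma> \<in> facets \<Phi>\<^sub>b"
    then show "R \<sigma> \<in> faces \<Phi>\<^sub>a \<union> faces \<Phi>\<^sub>b \<and> R \<sigma> \<subseteq> \<sigma>"
      using R\<^sub>b(1) by (simp add: R_b)
  qed
  moreover have "disjoint_family_on (\<lambda>\<sigma>. {R \<sigma>..\<sigma>}) (facets \<Phi>)"
  proof -
    have "disjoint_family_on (\<lambda>\<sigma>. {R \<sigma>..\<sigma>}) (facets \<Phi>\<^sub>a)"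
      using R\<^sub>a(2) by (simp add: disjoint_family_on_def R_a)
    moreover have "disjoint_family_on (\<lambda>\<sigma>. {R \<sigma>..\<sigma>}) (facets \<Phi>\<^sub>b)"
      using R\<^sub>b(2) by (simp add: disjoint_family_on_def R_b)
    moreover have "{R \<sigma>..\<sigma>} \<inter> {R \<tau>..\<tau>} = {}"
      if "\<sigma> \<in> facets \<Phi>\<^sub>a" "\<tau> \<in> facets \<Phi>\<^sub>b" for \<sigma> \<tau>
    proof -
      have "{R \<sigma>..\<sigma>} \<subseteq> faces \<Phi>\<^sub>a" and "{R \<tau>..\<tau>} \<subseteq> faces \<Phi>\<^sub>b"
        using that faces_a faces_b by blast+
      with disj show ?thesis
        by blast
    qed
    ultimately show ?thesis
      unfolding facets_eq disjoint_family_on_def by (metis Int_commute Un_iff)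
  qed
  moreover have "faces \<Phi> = (\<Union>\<sigma>\<in>facets \<Phi>. {R \<sigma>..\<sigma>})"
    unfolding faces_eq facets_eq faces_a faces_b by blast
  ultimately show ?thesis
    using rel unfolding partitionable_def by blast
qed

lemma simplicial_complex_Un:
  assumes "simplicial_complex \<Delta>" and "simplicial_complex \<Delta>'"
  shows "simplicial_complex (\<Delta> \<union> \<Delta>')"
proof -
  obtain V where V: "finite V" "\<Delta> \<subseteq> Pow V"
    using assms(1) unfolding simplicial_complex_def by (elim conjE exE)
  obtain V' where V': "finite V'" "\<Delta>' \<subseteq> Pow V'"
    using assms(2) unfolding simplicial_complex_def by (elim conjE exE)
  have "finite (V \<union> V') \<and> \<Delta> \<union> \<Delta>' \<subseteq> Pow (V \<union> V')"
    using V V' by auto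
  then have "\<exists>W. finite W \<and> \<Delta> \<union> \<Delta>' \<subseteq> Pow W"
    by (rule exI)
  moreover have "\<forall>\<sigma>\<in>\<Delta> \<union> \<Delta>'. \<forall>\<tau>. \<tau> \<subseteq> \<sigma> \<longrightarrow> \<tau> \<in> \<Delta> \<union> \<Delta>'"
    using assms unfolding simplicial_complex_def by (meson UnE UnI1 UnI2)
  ultimately show ?thesis
    unfolding simplicial_complex_def by (rule conjI)
qed

lemma faces_disjoint:
  assumes "\<Delta>\<^sub>a \<inter> \<Delta>\<^sub>b \<subseteq> \<Gamma>\<^sub>a \<union> \<Gamma>\<^sub>b"
  shows "faces (\<Delta>\<^sub>a, \<Gamma>\<^sub>a) \<inter> faces (\<Delta>\<^sub>b, \<Gamma>\<^sub>b) = {}"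
  using assms by (auto simp: faces_def)

text \<open>
  A set in just one of \<open>\<Delta>\<^sub>a\<close>, \<open>\<Delta>\<^sub>b\<close> is removed from the union exactly when it is removed from its own
  complex. A set in both is kept exactly when it avoids one of \<open>\<Gamma>\<^sub>a\<close>, \<open>\<Gamma>\<^sub>b\<close>, that is, when it is a
  face of one of the two pieces.
\<close>

lemma faces_glued:
  assumes "\<Gamma>\<^sub>a \<subseteq> \<Delta>\<^sub>a" and "\<Gamma>\<^sub>b \<subseteq> \<Delta>\<^sub>b"
  shows "faces (\<Delta>\<^sub>a \<union> \<Delta>\<^sub>b, (\<Gamma>\<^sub>a - \<Delta>\<^sub>b) \<union> (\<Gamma>\<^sub>b - \<Delta>\<^sub>a) \<union> (\<Gamma>\<^sub>a \<inter> \<Gamma>\<^sub>b))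
    = faces (\<Delta>\<^sub>a, \<Gamma>\<^sub>a) \<union> faces (\<Delta>\<^sub>b, \<Gamma>\<^sub>b)"
  using assms by (auto simp: faces_def)

theorem lemma3p1:
  fixes \<Delta>\<^sub>a \<Gamma>\<^sub>a \<Delta>\<^sub>b \<Gamma>\<^sub>b \<Sigma> :: "'a set set"
  assumes partitionable_a: "partitionable (\<Delta>\<^sub>a, \<Gamma>\<^sub>a)"
    and partitionable_b: "partitionable (\<Delta>\<^sub>b, \<Gamma>\<^sub>b)"
    and facets_not_nested:
      "\<forall>\<sigma>\<in>facets (\<Delta>\<^sub>a, \<Gamma>\<^sub>a). \<forall>\<tau>\<in>facets (\<Delta>\<^sub>b, \<Gamma>\<^sub>b). \<not> \<sigma> \<subset> \<tau> \<and> \<not> \<tau> \<subset> \<sigma>"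
    and Sigma_eq: "\<Sigma> = (\<Gamma>\<^sub>a - \<Delta>\<^sub>b) \<union> (\<Gamma>\<^sub>b - \<Delta>\<^sub>a) \<union> (\<Gamma>\<^sub>a \<inter> \<Gamma>\<^sub>b)"
    and G1: "\<Gamma>\<^sub>a \<union> \<Gamma>\<^sub>b \<supseteq> \<Delta>\<^sub>a \<inter> \<Delta>\<^sub>b"
    and G2: "subcomplex \<Sigma> (\<Delta>\<^sub>a \<union> \<Delta>\<^sub>b)"
  shows "partitionable (\<Delta>\<^sub>a \<union> \<Delta>\<^sub>b, \<Sigma>)"
proof (rule partitionable_disjoint_union[OF partitionable_a partitionable_b facets_not_nested])
  have rel_a: "relative_complex (\<Delta>\<^sub>a, \<Gamma>\<^sub>a)" and rel_b: "relative_complex (\<Delta>\<^sub>b, \<Gamma>\<^sub>b)"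
    using partitionable_a partitionable_b by (simp_all add: partitionable_imp_relative_complex)
  then show "relative_complex (\<Delta>\<^sub>a \<union> \<Delta>\<^sub>b, \<Sigma>)"
    using G2 by (simp add: relative_complex_def simplicial_complex_Un)
  show "faces (\<Delta>\<^sub>a \<union> \<Delta>\<^sub>b, \<Sigma>) = faces (\<Delta>\<^sub>a, \<Gamma>\<^sub>a) \<union> faces (\<Delta>\<^sub>b, \<Gamma>\<^sub>b)"
    unfolding Sigma_eq using rel_a rel_b
    by (intro faces_glued) (simp_all add: relative_complex_def subcomplex_def)
  show "faces (\<Delta>\<^sub>a, \<Gamma>\<^sub>a) \<inter> faces (\<Delta>\<^sub>b, \<Gamma>\<^sub>b) = {}"
    using G1 by (rule faces_disjoint)
qed

end
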